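(* For all $n\ge1$ and all integers $i_1,\ldots,i_n\ge1$, $$P(i_1,\ldots,i_n)\le\frac{(i_2+1)\cdots(i_{n-1}+1)}{(i_1+i_2+1)(i_2+i_3+1)\cdots(i_{n-1}+i_n+1)}\;\frac{1}{i_1!\cdots i_n!},$$ where empty products are equal to $1$.
   Context: For $N\ge1$ and a permutation $\pi$ of $\{1,\ldots,N+1\}$, the up-down signature of $\pi$ is $\sigma=(\sigma_1,\ldots,\sigma_N)\in\{1,-1\}^N$ with $\sigma_i=\mathrm{sign}(\pi(i+1)-\pi(i))$. For $\sigma\in\{1,-1\}^N$, $C(\sigma)$ denotes the number of permutations of $\{1,\ldots,N+1\}$ with up-down signature $\sigma$, and $P(\sigma)=C(\sigma)/(N+1)!$. For integers $i_1,\ldots,i_n\ge1$ with $N=i_1+\cdots+i_n$, the notation $(i_1,\ldots,i_n)$ denotes the signature of length $N$ consisting of $i_1$ entries $+1$, followed by $i_2$ entries $-1$, followed by $i_3$ entries $+1$, and so on with alternating signs; $P(i_1,\ldots,i_n)$ is $P$ of this signature. *)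

theory Defs
  imports Complex_Main "HOL-Combinatorics.Permutations"
begin

text \<open>A signature is a list over \<open>{1, -1}\<close>; the entry \<open>\<sigma>\<^sub>i\<close> is at list position \<open>i - 1\<close>.\<close>

definition updown_signature :: "nat \<Rightarrow> (nat \<Rightarrow> nat) \<Rightarrow> int list" where
  "updown_signature N p = map (\<lambda>i. sgn (int (p (i + 1)) - int (p i))) [1..<N + 1]"

definition signature_count :: "int list \<Rightarrow> nat" where
  "signature_count s =
     card {p. p permutes {1..length s + 1} \<and> updown_signature (length s) p = s}"

definition signature_prob :: "int list \<Rightarrow> real" where
  "signature_prob s = real (signature_count s) / fact (length s + 1)"

text \<open>The signature \<open>(i\<^sub>1, \<dots>, i\<^sub>n)\<close>. The run lengths are the values \<open>i 1, \<dots>, i n\<close>, other values of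
  \<open>i\<close> being irrelevant; the sign \<open>(-1)^(k + 1)\<close> makes the first run ascending.\<close>

definition run_signature :: "nat \<Rightarrow> (nat \<Rightarrow> nat) \<Rightarrow> int list" where
  "run_signature n i = concat (map (\<lambda>k. replicate (i k) ((-1) ^ (k + 1))) [1..<n + 1])"

end

theory Submission
  imports Defs
begin

text \<open>
  The bound is proved one run at a time: appending a run of length \<open>m\<close> to a signature whose last
  run has length \<open>a\<close> multiplies the probability by at most \<open>(a + 1) / ((a + m + 1) m!)\<close>. The
  product of these factors, starting from \<open>P(i\<^sub>1) = 1 / (i\<^sub>1 + 1)!\<close>, is the claimed bound (for
  \<open>n = 1\<close>, where nothing is appended, it is smaller than the claimed bound).

  Complementing the values of a permutation negates its signature, so the last run may be taken to
  be ascending. Let \<open>f(j)\<close> be the number of permutations with the given signature \<open>s\<close> of length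
  \<open>N\<close> whose last value has exactly \<open>j\<close> smaller values. Appending an ascent replaces \<open>f(j)\<close> by
  \<open>\<Sum>\<^sub>k\<^sub><\<^sub>j f(k)\<close>, appending a descent replaces it by \<open>\<Sum>\<^sub>k\<^sub>\<ge>\<^sub>j f(k)\<close>. Two
  consequences carry the argument.

  \<^item> Appending \<open>m\<close> descents gives \<open>\<Sum>\<^sub>j f(j) binom(j + m, m)\<close> permutations
    (\<open>signature_count_append_down\<close>).
  \<^item> If \<open>s\<close> ends in a run of \<open>a\<close> ascents, then \<open>f(j) / binom(j, a)\<close> is decreasing in \<open>j\<close>
    (\<open>ratio_decreasing_last_count\<close>): before that run the count is decreasing, being a tail sum
    or a single value, and taking partial sums of numerator and denominator keeps the ratio
    decreasing.

  Since the weight \<open>binom(j + m, m)\<close> is increasing, Chebyshev's sum inequality shows that its mean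
  with respect to \<open>f\<close> is at most its mean with respect to \<open>binom(j, a)\<close>, and the latter is a
  quotient of binomial coefficients (\<open>sum_choose_mult\<close>). Dividing by factorials gives the factor
  above (\<open>signature_prob_append_down_le\<close>).
\<close>

section \<open>Counting permutations by signature and last value\<close>

text \<open>The number of permutations with signature \<open>s\<close> whose last value is \<open>Suc j\<close>. The shift makes
  \<open>j\<close> the number of values below the last one, so that \<open>j\<close> ranges over \<open>{..length s}\<close>.\<close>

definition last_count :: "int list \<Rightarrow> nat \<Rightarrow> nat" where
  "last_count s j = card {p. p permutes {1..length s + 1} \<and>
     updown_signature (length s) p = s \<and> p (length s + 1) = Suc j}"

lemma finite_permutations_with:
  "finite A \<Longrightarrow> finite {p. p permutes A \<and> Q p}"
  by (rule finite_subset[OF _ finite_permutations[of A]]) auto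

lemma card_last_value_in:
  assumes "finite K"
  shows "card {p. p permutes {1..length s + 1} \<and> updown_signature (length s) p = s
            \<and> (\<exists>k\<in>K. p (length s + 1) = Suc k)} = (\<Sum>k\<in>K. last_count s k)"
proof -
  have "{p. p permutes {1..length s + 1} \<and> updown_signature (length s) p = s
            \<and> (\<exists>k\<in>K. p (length s + 1) = Suc k)}
     = (\<Union>k\<in>K. {p. p permutes {1..length s + 1} \<and> updown_signature (length s) p = s
            \<and> p (length s + 1) = Suc k})"
    by auto
  then show ?thesis
    unfolding last_count_def
    using assms by (simp only:) (subst card_UN_disjoint, auto intro: finite_permutations_with)
qed

lemma permutes_last_value:
  assumes "p permutes {1..Suc n}"
  shows "\<exists>k\<le>n. p (Suc n) = Suc k"
proof -
  have "p (Suc n) \<in> {1..Suc n}"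
    using permutes_in_image[OF assms, of "Suc n"] by simp
  then show ?thesis
    by (intro exI[of _ "p (Suc n) - 1"]) auto
qed

lemma signature_count_eq_sum: "signature_count s = (\<Sum>k\<le>length s. last_count s k)"
proof -
  have "{p. p permutes {1..length s + 1} \<and> updown_signature (length s) p = s}
     = {p. p permutes {1..length s + 1} \<and> updown_signature (length s) p = s
            \<and> (\<exists>k\<in>{..length s}. p (length s + 1) = Suc k)}"
    using permutes_last_value by fastforce
  then show ?thesis
    unfolding signature_count_def by (simp only: card_last_value_in finite_atMost)
qed

lemma updown_signature_Suc:
  "updown_signature (Suc N) p = updown_signature N p @ [sgn (int (p (N + 2)) - int (p (N + 1)))]"
  by (simp add: updown_signature_def)

text \<open>Insertion of a new last value \<open>Suc j\<close>, for \<open>j \<le> N + 1\<close>: as a permutation of \<open>{1..N + 2}\<close> this is the cycle that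
  sends \<open>N + 2\<close> to \<open>Suc j\<close> and shifts the values \<open>j + 1, \<dots>, N + 1\<close> up by one. If \<open>p\<close> is a
  permutation of \<open>{1..N + 1}\<close>, then \<open>insert_value N j \<circ> p\<close> ends in \<open>Suc j\<close> and has its first
  \<open>N + 1\<close> values in the same relative order as \<open>p\<close>.\<close>

definition insert_value :: "nat \<Rightarrow> nat \<Rightarrow> nat \<Rightarrow> nat" where
  "insert_value N j y =
     (if y \<le> j \<or> N + 2 < y then y else if y = N + 2 then Suc j else Suc y)"

lemma insert_value_permutes:
  assumes "j \<le> N + 1"
  shows "insert_value N j permutes {1..N + 2}"
proof (rule bij_imp_permutes)
  have "inj_on (insert_value N j) {1..N + 2}"
    using assms by (auto simp: inj_on_def insert_value_def split: if_splits)
  moreover have "insert_value N j ` {1..N + 2} \<subseteq> {1..N + 2}"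
    using assms by (auto simp: insert_value_def)
  ultimately show "bij_betw (insert_value N j) {1..N + 2} {1..N + 2}"
    by (simp add: bij_betw_def endo_inj_surj)
qed (use assms in \<open>auto simp: insert_value_def\<close>)

lemma sgn_diff_insert_value:
  assumes "u \<le> N + 1" "v \<le> N + 1"
  shows "sgn (int (insert_value N j u) - int (insert_value N j v)) = sgn (int u - int v)"
  using assms by (auto simp: insert_value_def sgn_if)

lemma updown_signature_insert_value:
  assumes p: "p permutes {1..N + 1}"
  shows "updown_signature N (insert_value N j \<circ> p) = updown_signature N p"
proof -
  have le: "p x \<le> N + 1" if "x \<in> {1..N + 1}" for x
    using permutes_in_image[OF p, of x] that by simp
  show ?thesis
    unfolding updown_signature_def
    by (intro map_cong refl) (auto simp only: o_apply intro!: sgn_diff_insert_value le, auto)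
qed

text \<open>Composition with \<open>insert_value\<close> is a bijection from the permutations of \<open>{1..N + 1}\<close> onto the
  permutations of \<open>{1..N + 2}\<close> that end in \<open>Suc j\<close>. It turns counts for \<open>s @ [e]\<close> into
  counts for \<open>s\<close>.\<close>

lemma last_count_snoc:
  assumes j: "j \<le> length s + 1"
  shows "last_count (s @ [e]) j = card {p. p permutes {1..length s + 1}
    \<and> updown_signature (length s) p = s
    \<and> sgn (int (Suc j) - int (insert_value (length s) j (p (length s + 1)))) = e}"
    (is "_ = card ?A")
proof -
  define N where "N = length s"
  define c where "c = insert_value N j"
  define B where "B = {q. q permutes {1..N + 2} \<and> updown_signature (N + 1) q = s @ [e]
      \<and> q (N + 2) = Suc j}"
  have c: "c permutes {1..N + 2}"
    unfolding c_def using j by (intro insert_value_permutes) (simp add: N_def)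
  have cN: "c (N + 2) = Suc j"
    using j by (auto simp: c_def insert_value_def N_def)
  have A: "?A = {p. p permutes {1..N + 1} \<and> updown_signature N p = s
     \<and> sgn (int (Suc j) - int (c (p (N + 1)))) = e}"
    by (simp add: N_def c_def)
  have fwd: "c \<circ> p \<in> B \<longleftrightarrow> p \<in> ?A" if p: "p permutes {1..N + 1}" for p
  proof -
    have "p (N + 2) = N + 2"
      using permutes_not_in[OF p] by simp
    then have last: "(c \<circ> p) (N + 2) = Suc j"
      using cN by simp
    then have sig: "updown_signature (N + 1) (c \<circ> p)
        = updown_signature N p @ [sgn (int (Suc j) - int (c (p (N + 1))))]"
      using updown_signature_insert_value[OF p, of j, folded c_def]
        updown_signature_Suc[of N "c \<circ> p"] by simp
    have "p permutes {1..N + 2}"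
      by (rule permutes_subset[OF p]) auto
    then have "(c \<circ> p) permutes {1..N + 2}"
      using c by (rule permutes_compose)
    then show ?thesis
      unfolding A B_def mem_Collect_eq sig last using p by simp
  qed
  have "bij_betw ((\<circ>) c) ?A B"
  proof (rule bij_betw_byWitness[where f' = "(\<circ>) (inv c)"])
    show "\<forall>p\<in>?A. inv c \<circ> (c \<circ> p) = p"
      unfolding o_assoc permutes_inv_o(2)[OF c] by simp
    show "\<forall>q\<in>B. c \<circ> (inv c \<circ> q) = q"
      unfolding o_assoc permutes_inv_o(1)[OF c] by simp
    show "(\<circ>) c ` ?A \<subseteq> B"
      using fwd by (auto simp: N_def)
    show "(\<circ>) (inv c) ` B \<subseteq> ?A"
    proof (rule image_subsetI)
      fix q assume q: "q \<in> B"
      have perm: "(inv c \<circ> q) permutes {1..N + 2}"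
        using q permutes_compose[OF _ permutes_inv[OF c]] by (auto simp: B_def)
      have fix_last: "(inv c \<circ> q) (N + 2) = N + 2"
        using q cN permutes_inv_eq[OF c] by (simp add: B_def)
      \<comment> \<open>A permutation of \<open>{1..N + 2}\<close> that fixes \<open>N + 2\<close> is one of \<open>{1..N + 1}\<close>.\<close>
      have "(inv c \<circ> q) permutes {1..N + 1}"
        by (rule permutes_superset[OF perm]) (use fix_last in \<open>auto simp: le_Suc_eq\<close>)
      then have "c \<circ> (inv c \<circ> q) \<in> B \<longleftrightarrow> inv c \<circ> q \<in> ?A"
        by (rule fwd)
      moreover have "c \<circ> (inv c \<circ> q) = q"
        unfolding o_assoc permutes_inv_o(1)[OF c] by (rule id_o)
      ultimately show "inv c \<circ> q \<in> ?A"
        using q by (simp only:)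
    qed
  qed
  then have "card ?A = card B"
    by (rule bij_betw_same_card)
  then show ?thesis
    by (simp add: last_count_def B_def N_def)
qed

lemma last_count_snoc_up:
  assumes j: "j \<le> length s + 1"
  shows "last_count (s @ [1]) j = (\<Sum>k<j. last_count s k)"
proof -
  have "sgn (int (Suc j) - int (insert_value (length s) j (p (length s + 1)))) = 1
      \<longleftrightarrow> (\<exists>k\<in>{..<j}. p (length s + 1) = Suc k)"
    if "p permutes {1..length s + 1}" for p
    using permutes_last_value[of p "length s"] that
    by (auto simp: insert_value_def sgn_if)
  then show ?thesis
    unfolding last_count_snoc[OF j] card_last_value_in[OF finite_lessThan, symmetric]
    by (metis (no_types, lifting))
qed

lemma last_count_snoc_down:
  assumes j: "j \<le> length s + 1"
  shows "last_count (s @ [-1]) j = (\<Sum>k=j..length s. last_count s k)"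
proof -
  have "sgn (int (Suc j) - int (insert_value (length s) j (p (length s + 1)))) = -1
      \<longleftrightarrow> (\<exists>k\<in>{j..length s}. p (length s + 1) = Suc k)"
    if "p permutes {1..length s + 1}" for p
    using permutes_last_value[of p "length s"] that
    by (auto simp: insert_value_def sgn_if)
  then show ?thesis
    unfolding last_count_snoc[OF j] card_last_value_in[OF finite_atLeastAtMost, symmetric]
    by (metis (no_types, lifting))
qed

lemma last_count_Nil: "last_count [] 0 = 1"
proof -
  have "{p. p permutes {1..length [] + 1} \<and>
     updown_signature (length []) p = [] \<and> p (length [] + 1) = Suc 0} = {id}"
    by (auto simp: updown_signature_def permutes_sing)
  then show ?thesis
    by (simp add: last_count_def)
qed

lemma last_count_all_up:
  "j \<le> a \<Longrightarrow> last_count (replicate a 1) j = (if j = a then 1 else 0)"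
proof (induction a arbitrary: j)
  case 0
  then show ?case by (simp add: last_count_Nil)
next
  case (Suc a)
  have "last_count (replicate (Suc a) 1) j = (\<Sum>k<j. last_count (replicate a 1) k)"
    using last_count_snoc_up[of j "replicate a 1"] Suc.prems
    by (simp add: replicate_append_same)
  also have "\<dots> = (\<Sum>k<j. if k = a then 1 else 0)"
    using Suc by (intro sum.cong) auto
  also have "\<dots> = (if j = Suc a then 1 else 0)"
    using Suc.prems by auto
  finally show ?case .
qed

lemma signature_count_all_up: "signature_count (replicate a 1) = 1"
  by (simp add: signature_count_eq_sum last_count_all_up)

lemma signature_count_map_uminus: "signature_count (map uminus s) = signature_count s"
proof -
  define N where "N = length s"
  define c where "c = (\<lambda>x. if x \<in> {1..N + 1} then N + 2 - x else x)"
  have cc: "c \<circ> c = id"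
    by (auto simp: c_def fun_eq_iff)
  have c: "c permutes {1..N + 1}"
  proof (rule bij_imp_permutes)
    show "bij_betw c {1..N + 1} {1..N + 1}"
      by (rule bij_betw_byWitness[where f' = c]) (auto simp: c_def)
  qed (auto simp: c_def)
  have sig: "updown_signature N (c \<circ> p) = map uminus (updown_signature N p)"
    if p: "p permutes {1..N + 1}" for p
  proof -
    have rng: "p x \<in> {1..N + 1}" if "x \<in> {1..N + 1}" for x
      using permutes_in_image[OF p, of x] that by simp
    have "sgn (int (c (p (x + 1))) - int (c (p x))) = - sgn (int (p (x + 1)) - int (p x))"
      if "x \<in> set [1..<N + 1]" for x
      using rng[of x] rng[of "x + 1"] that by (auto simp: c_def sgn_if of_nat_diff)
    then show ?thesis
      unfolding updown_signature_def map_map by (intro map_cong) auto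
  qed
  define S where "S = (\<lambda>s. {p. p permutes {1..N + 1} \<and> updown_signature N p = s})"
  have maps: "c \<circ> p \<in> S (map uminus t)" if "p \<in> S t" for p t
    using that sig[of p] permutes_compose[OF _ c, of p] by (auto simp: S_def)
  have "bij_betw ((\<circ>) c) (S s) (S (map uminus s))"
  proof (rule bij_betw_byWitness[where f' = "(\<circ>) c"])
    have "map uminus (map uminus s) = s"
      by (simp add: o_def)
    then show "(\<circ>) c ` S (map uminus s) \<subseteq> S s"
      using maps[of _ "map uminus s"] by auto
    show "(\<circ>) c ` S s \<subseteq> S (map uminus s)"
      using maps by blast
  qed (unfold o_assoc cc, simp_all)
  then have "card (S s) = card (S (map uminus s))"
    by (rule bij_betw_same_card)
  then show ?thesis
    by (simp add: signature_count_def S_def N_def)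
qed

lemma signature_prob_map_uminus: "signature_prob (map uminus s) = signature_prob s"
  by (simp add: signature_prob_def signature_count_map_uminus)

section \<open>Appending descents\<close>

text \<open>The binomial coefficient counts the ways to choose, relative to the \<open>j\<close> values below the
  current last one, the positions of \<open>m\<close> further descending values.\<close>

lemma signature_count_append_down:
  "signature_count (s @ replicate m (-1)) = (\<Sum>j\<le>length s. last_count s j * ((j + m) choose m))"
proof (induction m arbitrary: s)
  case 0
  then show ?case by (simp add: signature_count_eq_sum)
next
  case (Suc m)
  let ?N = "length s"
  have "signature_count (s @ replicate (Suc m) (-1))
      = (\<Sum>j\<le>Suc ?N. last_count (s @ [-1]) j * ((j + m) choose m))"
    using Suc.IH[of "s @ [-1]"] by simp
  also have "\<dots> = (\<Sum>j\<le>?N. (\<Sum>k=j..?N. last_count s k) * ((j + m) choose m))"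
    by (simp add: last_count_snoc_down)
  also have "\<dots> = (\<Sum>j\<le>?N. \<Sum>k=j..?N. last_count s k * ((j + m) choose m))"
    by (simp add: sum_distrib_right)
  also have "\<dots> = (\<Sum>k\<le>?N. \<Sum>j\<le>k. last_count s k * ((j + m) choose m))"
  proof -
    let ?g = "\<lambda>j k. last_count s k * ((j + m) choose m)"
    have "(\<Sum>j\<le>?N. \<Sum>k=j..?N. ?g j k) = (\<Sum>j\<le>?N. \<Sum>k\<in>{k \<in> {..?N}. j \<le> k}. ?g j k)"
      by (intro sum.cong) auto
    also have "\<dots> = (\<Sum>k\<le>?N. \<Sum>j\<in>{j \<in> {..?N}. j \<le> k}. ?g j k)"
      by (intro sum.swap_restrict) auto
    also have "\<dots> = (\<Sum>k\<le>?N. \<Sum>j\<le>k. ?g j k)"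
      by (intro sum.cong) auto
    finally show ?thesis .
  qed
  also have "\<dots> = (\<Sum>k\<le>?N. last_count s k * ((k + Suc m) choose Suc m))"
    using choose_rising_sum(1)[of m] by (simp add: sum_distrib_left[symmetric] add.commute)
  finally show ?case .
qed

section \<open>Decreasing ratios and Chebyshev's inequality\<close>

text \<open>The ratio \<open>f / h\<close> is weakly decreasing on \<open>{..N}\<close>, in cross-multiplied form so that \<open>h\<close> may
  vanish.\<close>

definition ratio_decreasing :: "nat \<Rightarrow> (nat \<Rightarrow> nat) \<Rightarrow> (nat \<Rightarrow> nat) \<Rightarrow> bool" where
  "ratio_decreasing N f h \<longleftrightarrow> (\<forall>a b. a \<le> b \<longrightarrow> b \<le> N \<longrightarrow> f b * h a \<le> f a * h b)"

lemma ratio_decreasing_partial_sums: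
  assumes "ratio_decreasing N f h"
  shows "ratio_decreasing (Suc N) (\<lambda>j. \<Sum>k<j. f k) (\<lambda>j. \<Sum>k<j. h k)"
  unfolding ratio_decreasing_def
proof (intro allI impI)
  fix a b assume ab: "a \<le> b" "b \<le> Suc N"
  have split: "(\<Sum>k<b. g k) = (\<Sum>k<a. g k) + (\<Sum>k=a..<b. g k)" for g :: "nat \<Rightarrow> nat"
    using ab by (simp add: lessThan_atLeast0 sum.atLeastLessThan_concat)
  have "(\<Sum>k=a..<b. f k) * (\<Sum>l<a. h l) \<le> (\<Sum>k=a..<b. h k) * (\<Sum>l<a. f l)"
    unfolding sum_product
  proof (intro sum_mono)
    fix k l assume "k \<in> {a..<b}" "l \<in> {..<a}"
    then have "f k * h l \<le> f l * h k"
      using assms ab by (auto simp: ratio_decreasing_def)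
    then show "f k * h l \<le> h k * f l"
      by (simp add: mult.commute)
  qed
  then show "(\<Sum>k<b. f k) * (\<Sum>k<a. h k) \<le> (\<Sum>k<a. f k) * (\<Sum>k<b. h k)"
    unfolding split by (simp add: algebra_simps)
qed

text \<open>Chebyshev's sum inequality: the \<open>f\<close>-weighted mean of an increasing function is at most its
  \<open>h\<close>-weighted mean if \<open>f / h\<close> is decreasing.\<close>

lemma chebyshev_ratio_decreasing:
  fixes w :: "nat \<Rightarrow> nat"
  assumes fh: "ratio_decreasing N f h" and w: "mono w"
  shows "(\<Sum>j\<le>N. f j * w j) * (\<Sum>j\<le>N. h j) \<le> (\<Sum>j\<le>N. h j * w j) * (\<Sum>j\<le>N. f j)"
proof -
  define F H W where "F = (\<lambda>j. int (f j))" and "H = (\<lambda>j. int (h j))" and "W = (\<lambda>j. int (w j))"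
  have le: "(F x * H y - H x * F y) * (W x - W y) \<le> 0" if "y \<le> x" "x \<le> N" for x y
  proof -
    have "f x * h y \<le> f y * h x"
      using fh that by (simp add: ratio_decreasing_def)
    then have "F x * H y - H x * F y \<le> 0"
      unfolding F_def H_def by (simp flip: of_nat_mult add: mult.commute)
    moreover have "W x - W y \<ge> 0"
      using monoD[OF w that(1)] by (simp add: W_def)
    ultimately show ?thesis
      by (rule mult_nonpos_nonneg)
  qed
  have le': "(F x * H y - H x * F y) * (W x - W y) \<le> 0" if "x \<le> N" "y \<le> N" for x y
    using le[of x y] le[of y x] that by (cases "y \<le> x") (auto simp: algebra_simps)
  \<comment> \<open>Symmetrising over pairs makes every summand nonpositive.\<close>
  have "2 * ((\<Sum>j\<le>N. F j * W j) * (\<Sum>j\<le>N. H j) - (\<Sum>j\<le>N. H j * W j) * (\<Sum>j\<le>N. F j))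
      = (\<Sum>x\<le>N. \<Sum>y\<le>N. (F x * H y - H x * F y) * (W x - W y))"
  proof -
    have "(\<Sum>x\<le>N. \<Sum>y\<le>N. (F x * H y - H x * F y) * (W x - W y))
       = (\<Sum>x\<le>N. \<Sum>y\<le>N. (F x * W x) * H y - (H x * W x) * F y)
         + (\<Sum>x\<le>N. \<Sum>y\<le>N. H x * (F y * W y) - F x * (H y * W y))"
      by (simp add: sum.distrib[symmetric] algebra_simps)
    also have "\<dots> = ((\<Sum>j\<le>N. F j * W j) * (\<Sum>j\<le>N. H j) - (\<Sum>j\<le>N. H j * W j) * (\<Sum>j\<le>N. F j))
      + ((\<Sum>j\<le>N. H j) * (\<Sum>j\<le>N. F j * W j) - (\<Sum>j\<le>N. F j) * (\<Sum>j\<le>N. H j * W j))"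
      by (simp only: sum_subtractf sum_product)
    finally show ?thesis
      by (simp add: algebra_simps)
  qed
  also have "\<dots> \<le> 0"
    by (intro sum_nonpos le') auto
  finally have "(\<Sum>j\<le>N. F j * W j) * (\<Sum>j\<le>N. H j) \<le> (\<Sum>j\<le>N. H j * W j) * (\<Sum>j\<le>N. F j)"
    by simp
  then have "int ((\<Sum>j\<le>N. f j * w j) * (\<Sum>j\<le>N. h j)) \<le> int ((\<Sum>j\<le>N. h j * w j) * (\<Sum>j\<le>N. f j))"
    by (simp add: F_def H_def W_def)
  then show ?thesis
    by (simp only: of_nat_le_iff)
qed

text \<open>Summing a constant \<open>a\<close> times gives \<open>binom(j, a)\<close>; the count for \<open>s\<close> itself is decreasing,
  as a tail sum (after a descent) or as a single value (for \<open>s = []\<close>).\<close>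

lemma ratio_decreasing_last_count:
  assumes "s = [] \<or> last s = -1"
  shows "ratio_decreasing (length s + a) (last_count (s @ replicate a 1)) (\<lambda>j. j choose a)"
proof (induction a)
  case 0
  show ?case
  proof (cases "s = []")
    case True
    then show ?thesis by (simp add: ratio_decreasing_def)
  next
    case False
    then obtain t where t: "s = t @ [-1]"
      using assms by (metis append_butlast_last_id)
    have "(\<Sum>k=b..length t. last_count t k) \<le> (\<Sum>k=a..length t. last_count t k)" if "a \<le> b" for a b
      using that by (intro sum_mono2) auto
    then show ?thesis
      by (auto simp: ratio_decreasing_def t last_count_snoc_down)
  qed
next
  case (Suc a)
  let ?t = "s @ replicate a 1"
  have "ratio_decreasing (Suc (length s + a)) (\<lambda>j. \<Sum>k<j. last_count ?t k) (\<lambda>j. \<Sum>k<j. k choose a)"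
    using Suc.IH by (rule ratio_decreasing_partial_sums)
  moreover have "(\<Sum>k<j. k choose a) = j choose Suc a" for j
    by (induction j) auto
  moreover have "last_count (s @ replicate (Suc a) 1) j = (\<Sum>k<j. last_count ?t k)"
    if "j \<le> Suc (length s + a)" for j
    using last_count_snoc_up[of j ?t] that by (simp add: replicate_append_same)
  ultimately show ?case
    by (simp add: ratio_decreasing_def)
qed

section \<open>The effect of one further run\<close>

lemma sum_choose_mult:
  "(\<Sum>j\<le>N. (j choose a) * ((j + m) choose m)) = ((a + m) choose m) * (Suc (N + m) choose Suc (a + m))"
proof -
  have "(j choose a) * ((j + m) choose m) = ((a + m) choose m) * ((j + m) choose (a + m))" for j
  proof (cases "a \<le> j")
    case True
    then show ?thesis
      using choose_mult[of m "a + m" "j + m"] by (simp add: mult.commute)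
  qed (simp add: binomial_eq_0)
  then have "(\<Sum>j\<le>N. (j choose a) * ((j + m) choose m))
      = ((a + m) choose m) * (\<Sum>j\<le>N. (j + m) choose (a + m))"
    by (simp add: sum_distrib_left)
  also have "(\<Sum>j\<le>N. (j + m) choose (a + m)) = Suc (N + m) choose Suc (a + m)"
    by (induction N) (auto simp: binomial_eq_0)
  finally show ?thesis .
qed

lemma signature_prob_append_down_le:
  assumes "s = [] \<or> last s = -1"
  shows "signature_prob (s @ replicate a 1 @ replicate m (-1))
    \<le> signature_prob (s @ replicate a 1) * ((real a + 1) / ((real a + real m + 1) * fact m))"
proof -
  define t where "t = s @ replicate a (1::int)"
  define N where "N = length t"
  have aN: "a \<le> N"
    by (simp add: N_def t_def)
  have "mono (\<lambda>j. (j + m) choose m)"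
    by (auto simp: mono_def intro: binomial_right_mono)
  then have "(\<Sum>j\<le>N. last_count t j * ((j + m) choose m)) * (\<Sum>j\<le>N. j choose a)
      \<le> (\<Sum>j\<le>N. (j choose a) * ((j + m) choose m)) * (\<Sum>j\<le>N. last_count t j)"
    using ratio_decreasing_last_count[OF assms, of a]
    by (intro chebyshev_ratio_decreasing) (simp_all add: N_def t_def)
  then have "signature_count (t @ replicate m (-1)) * (Suc N choose Suc a)
      \<le> ((a + m) choose m) * (Suc (N + m) choose Suc (a + m)) * signature_count t"
    using signature_count_append_down[of t m] signature_count_eq_sum[of t]
      sum_choose_mult[of a m N] sum_choose_upper[of a N]
    by (simp only: N_def atLeast0AtMost)
  then have le: "real (signature_count (t @ replicate m (-1))) * real (Suc N choose Suc a)
      \<le> real ((a + m) choose m) * real (Suc (N + m) choose Suc (a + m)) * real (signature_count t)"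
    by (simp only: of_nat_mult[symmetric] of_nat_le_iff)
  have b1: "real (Suc N choose Suc a) = fact (Suc N) / (fact (Suc a) * fact (N - a))"
    using aN binomial_fact[of "Suc a" "Suc N", where 'a=real] by simp
  have b2: "real (Suc (N + m) choose Suc (a + m)) = fact (Suc (N + m)) / (fact (Suc (a + m)) * fact (N - a))"
    using aN binomial_fact[of "Suc (a + m)" "Suc (N + m)", where 'a=real] by simp
  have b3: "real ((a + m) choose m) = fact (a + m) / (fact m * fact a)"
    using binomial_fact[of m "a + m", where 'a=real] by simp
  have "real (signature_count (t @ replicate m (-1)))
      \<le> real ((a + m) choose m) * real (Suc (N + m) choose Suc (a + m)) * real (signature_count t)
         / real (Suc N choose Suc a)"
    using le aN by (simp add: pos_le_divide_eq zero_less_binomial_iff del: binomial_Suc_Suc)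
  also have "\<dots> = real (signature_count t) * ((real a + 1) / ((real a + real m + 1) * fact m))
       * (fact (Suc (N + m)) / fact (Suc N))"
  proof -
    have cancel: "(U / (M * V)) * (X / ((p * U) * Z)) * S / (Y / ((q * V) * Z))
        = S * (q / (p * M)) * (X / Y)"
      if "U \<noteq> 0" "M \<noteq> 0" "V \<noteq> 0" "X \<noteq> 0" "Y \<noteq> 0" "Z \<noteq> 0" "p \<noteq> 0" "q \<noteq> 0"
      for U M V X Y Z p q S :: real
      using that by (simp add: field_simps)
    have "fact (Suc (a + m)) = (real a + real m + 1) * (fact (a + m) :: real)"
      "fact (Suc a) = (real a + 1) * (fact a :: real)"
      by (simp_all add: add_ac)
    then show ?thesis
      unfolding b1 b2 b3 by (simp only:) (rule cancel; simp del: fact_Suc)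
  qed
  finally have "real (signature_count (t @ replicate m (-1))) / fact (Suc (N + m))
      \<le> real (signature_count t) * ((real a + 1) / ((real a + real m + 1) * fact m)) / fact (Suc N)"
    by (simp add: field_simps del: fact_Suc)
  then show ?thesis
    by (simp add: signature_prob_def t_def N_def add_ac mult_ac del: fact_Suc)
qed

lemma signature_prob_append_run_le:
  assumes e: "e = 1 \<or> e = -1" and s: "s = [] \<or> last s = - e"
  shows "signature_prob (s @ replicate a e @ replicate m (- e))
    \<le> signature_prob (s @ replicate a e) * ((real a + 1) / ((real a + real m + 1) * fact m))"
proof (cases "e = 1")
  case True
  then show ?thesis
    using signature_prob_append_down_le[of s a m] s by simp
next
  case False
  then have "e = -1"
    using e by simp
  moreover have "map uminus s = [] \<or> last (map uminus s) = -1"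
    using s \<open>e = -1\<close> by (cases "s = []") (auto simp: last_map)
  ultimately show ?thesis
    using signature_prob_append_down_le[of "map uminus s" a m]
      signature_prob_map_uminus[of "s @ replicate a e @ replicate m (- e)"]
      signature_prob_map_uminus[of "s @ replicate a e"]
    by simp
qed

section \<open>Induction on the number of runs\<close>

lemma run_signature_Suc:
  "run_signature (Suc n) i = run_signature n i @ replicate (i (Suc n)) ((-1) ^ n)"
  by (simp add: run_signature_def)

text \<open>The denominator \<open>i 1 + 1\<close> cancels the first factor of the numerator for \<open>n \<ge> 1\<close>. For
  \<open>n = 0\<close> it remains, which makes the right-hand side the exact value for a single run, as
  needed to start the induction.\<close>

lemma signature_prob_run_signature_le:
  assumes "\<And>k. k \<in> {1..Suc n} \<Longrightarrow> i k \<ge> 1"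
  shows "signature_prob (run_signature (Suc n) i)
    \<le> (\<Prod>k\<in>{1..n}. real (i k) + 1) / (\<Prod>k\<in>{1..n}. real (i k) + real (i (k + 1)) + 1)
       / (\<Prod>k\<in>{1..Suc n}. fact (i k)) / (real (i 1) + 1)"
  using assms
proof (induction n)
  case 0
  show ?case
    by (simp add: run_signature_def signature_prob_def signature_count_all_up field_simps)
next
  case (Suc n)
  let ?s = "run_signature n i"
  let ?r = "(real (i (Suc n)) + 1) / ((real (i (Suc n)) + real (i (Suc (Suc n))) + 1)
              * fact (i (Suc (Suc n))))"
  have last: "?s = [] \<or> last ?s = - ((-1) ^ n)"
  proof (cases n)
    case 0
    then show ?thesis by (simp add: run_signature_def)
  next
    case (Suc n')
    then have "i n \<noteq> 0"
      using Suc.prems[of n] by auto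
    then show ?thesis
      using Suc by (simp add: run_signature_Suc)
  qed
  have sign: "(-1 :: int) ^ n = 1 \<or> (-1 :: int) ^ n = -1"
    by (cases "even n") auto
  have "signature_prob (run_signature (Suc (Suc n)) i)
      \<le> signature_prob (run_signature (Suc n) i) * ?r"
    using signature_prob_append_run_le[OF _ last, of "i (Suc n)" "i (Suc (Suc n))"] sign
    by (simp add: run_signature_Suc)
  also have "\<dots> \<le> (\<Prod>k\<in>{1..n}. real (i k) + 1) / (\<Prod>k\<in>{1..n}. real (i k) + real (i (k + 1)) + 1)
       / (\<Prod>k\<in>{1..Suc n}. fact (i k)) / (real (i 1) + 1) * ?r"
    by (intro mult_right_mono Suc.IH Suc.prems) auto
  also have "\<dots> = (\<Prod>k\<in>{1..Suc n}. real (i k) + 1)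
      / (\<Prod>k\<in>{1..Suc n}. real (i k) + real (i (k + 1)) + 1)
       / (\<Prod>k\<in>{1..Suc (Suc n)}. fact (i k)) / (real (i 1) + 1)"
    by (simp add: prod.nat_ivl_Suc' mult_ac)
  finally show ?case .
qed

theorem theorem2p9:
  fixes n :: nat and i :: "nat \<Rightarrow> nat"
  assumes "n \<ge> 1"
    and "\<And>k. k \<in> {1..n} \<Longrightarrow> i k \<ge> 1"
  shows "signature_prob (run_signature n i)
    \<le> (\<Prod>k\<in>{2..<n}. real (i k) + 1) / (\<Prod>k\<in>{1..<n}. real (i k) + real (i (k + 1)) + 1)
       * (1 / (\<Prod>k\<in>{1..n}. fact (i k)))"
proof -
  obtain m where n: "n = Suc m"
    using assms(1) by (cases n) auto
  define D where "D = (\<Prod>k\<in>{1..<n}. real (i k) + real (i (k + 1)) + 1)"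
  define G where "G = (\<Prod>k\<in>{1..n}. fact (i k) :: real)"
  have "(\<Prod>k\<in>{1..m}. real (i k) + 1) / (real (i 1) + 1) \<le> (\<Prod>k\<in>{2..<n}. real (i k) + 1)"
  \<comment> \<open>Equality unless \<open>m = 0\<close>, where the left-hand side is \<open>1 / (i 1 + 1)\<close>.\<close>
  proof (cases "m = 0")
    case False
    then have "{1..m} = insert 1 {2..<n}"
      using n by auto
    then show ?thesis
      by simp
  qed (simp add: n)
  moreover have "D > 0" "G > 0"
    unfolding D_def G_def by (auto intro!: prod_pos)
  ultimately have "(\<Prod>k\<in>{1..m}. real (i k) + 1) / (real (i 1) + 1) / (D * G)
      \<le> (\<Prod>k\<in>{2..<n}. real (i k) + 1) / (D * G)"
    by (intro divide_right_mono) auto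
  moreover have "signature_prob (run_signature n i)
      \<le> (\<Prod>k\<in>{1..m}. real (i k) + 1) / D / G / (real (i 1) + 1)"
    using signature_prob_run_signature_le[of m i] assms(2)
    by (simp add: n D_def G_def atLeastLessThanSuc_atLeastAtMost)
  ultimately show ?thesis
    unfolding D_def[symmetric] G_def[symmetric] by (simp add: mult_ac)
qed

end
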